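(* (a) Suppose that $f:[0,1]\to\mathbb R$ is a convex function. Then $\mathrm{INT}_f(\cdot)$ is cut distance compatible, i.e. for any two graphons $W_1\preceq W_2$ we have $\mathrm{INT}_f(W_1)\le\mathrm{INT}_f(W_2)$. (b) Suppose that $f:[0,1]\to\mathbb R$ is a strictly convex function. Then $\mathrm{INT}_f(\cdot)$ is cut distance identifying, i.e. for any two graphons $W_1\prec W_2$ we have $\mathrm{INT}_f(W_1)<\mathrm{INT}_f(W_2)$.
   Context: $\Omega$ is a standard Borel space with an atomless probability measure $\nu$. A graphon is a symmetric measurable function $W:\Omega^2\to[0,1]$ (modulo null sets). For a measure preserving bijection $\varphi:\Omega\to\Omega$ put $W^\varphi(x,y)=W(\varphi(x),\varphi(y))$. Graphons $\Gamma_n$ converge weak* to $W$ if $\int_{S\times T}\Gamma_n\to\int_{S\times T}W$ for all measurable $S,T\subset\Omega$. The envelope $\langle W\rangle$ is the set of all graphons $U$ for which there are measure preserving bijections $\pi_1,\pi_2,\ldots$ of $\Omega$ with $W^{\pi_n}\to U$ weak*. Write $U\preceq W$ if $\langle U\rangle\subset\langle W\rangle$, and $U\prec W$ if $U\preceq W$ but not $W\preceq U$. For $f:[0,1]\to\mathbb R$ (not assumed continuous) and a graphon $W$, $\mathrm{INT}_f(W):=\int_x\int_yf(W(x,y))$. *)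

theory Defs
  imports "HOL-Probability.Probability"
begin

definition standard_borel :: "'a measure \<Rightarrow> bool" where
  "standard_borel M \<longleftrightarrow>
     (\<exists>X. topspace X = space M \<and> completely_metrizable_space X \<and> second_countable X \<and>
          sets M = sigma_sets (space M) {U. openin X U})"

definition atomless :: "'a measure \<Rightarrow> bool" where
  "atomless M \<longleftrightarrow>
     (\<forall>A\<in>sets M. 0 < emeasure M A \<longrightarrow>
        (\<exists>B\<in>sets M. B \<subseteq> A \<and> 0 < emeasure M B \<and> emeasure M B < emeasure M A))"

text \<open>
  Graphons are handled through representatives: values outside \<open>space M\<close> are irrelevant, and
  no quotient by null sets is formed. Replacing a graphon by another one that is
  almost everywhere equal affects neither weak* limits, nor its envelope, nor the integrals below.
  Among graphons, an envelope is closed under almost everywhere equality, so an inclusion of envelopes of representatives is an inclusion of envelopes of classes.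
\<close>

definition graphon :: "'a measure \<Rightarrow> ('a \<Rightarrow> 'a \<Rightarrow> real) \<Rightarrow> bool" where
  "graphon M W \<longleftrightarrow>
     (\<lambda>(x, y). W x y) \<in> borel_measurable (M \<Otimes>\<^sub>M M) \<and>
     (\<forall>x\<in>space M. \<forall>y\<in>space M. W x y = W y x \<and> W x y \<in> {0..1})"

text \<open>
  As usual, the inverse of a measure preserving bijection is required to be measurable too;
  on a standard Borel space this holds automatically (Lusin-Souslin).
\<close>

definition mp_bijection :: "'a measure \<Rightarrow> ('a \<Rightarrow> 'a) \<Rightarrow> bool" where
  "mp_bijection M \<phi> \<longleftrightarrow>
     bij_betw \<phi> (space M) (space M) \<and>
     \<phi> \<in> measurable M M \<and> inv_into (space M) \<phi> \<in> measurable M M \<and>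
     (\<forall>A\<in>sets M. emeasure M (\<phi> -` A \<inter> space M) = emeasure M A)"

definition pullback :: "('a \<Rightarrow> 'a \<Rightarrow> real) \<Rightarrow> ('a \<Rightarrow> 'a) \<Rightarrow> 'a \<Rightarrow> 'a \<Rightarrow> real" where
  "pullback W \<phi> = (\<lambda>x y. W (\<phi> x) (\<phi> y))"

definition weak_star_conv ::
  "'a measure \<Rightarrow> (nat \<Rightarrow> 'a \<Rightarrow> 'a \<Rightarrow> real) \<Rightarrow> ('a \<Rightarrow> 'a \<Rightarrow> real) \<Rightarrow> bool" where
  "weak_star_conv M \<Gamma> W \<longleftrightarrow>
     (\<forall>S\<in>sets M. \<forall>T\<in>sets M.
        (\<lambda>n. set_lebesgue_integral (M \<Otimes>\<^sub>M M) (S \<times> T) (\<lambda>(x, y). \<Gamma> n x y))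
          \<longlonglongrightarrow> set_lebesgue_integral (M \<Otimes>\<^sub>M M) (S \<times> T) (\<lambda>(x, y). W x y))"

definition envelope :: "'a measure \<Rightarrow> ('a \<Rightarrow> 'a \<Rightarrow> real) \<Rightarrow> ('a \<Rightarrow> 'a \<Rightarrow> real) set" where
  "envelope M W =
     {U. graphon M U \<and>
         (\<exists>\<pi>. (\<forall>n. mp_bijection M (\<pi> n)) \<and> weak_star_conv M (\<lambda>n. pullback W (\<pi> n)) U)}"

definition structurally_le ::
  "'a measure \<Rightarrow> ('a \<Rightarrow> 'a \<Rightarrow> real) \<Rightarrow> ('a \<Rightarrow> 'a \<Rightarrow> real) \<Rightarrow> bool" where
  "structurally_le M U W \<longleftrightarrow> envelope M U \<subseteq> envelope M W"

definition structurally_less ::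
  "'a measure \<Rightarrow> ('a \<Rightarrow> 'a \<Rightarrow> real) \<Rightarrow> ('a \<Rightarrow> 'a \<Rightarrow> real) \<Rightarrow> bool" where
  "structurally_less M U W \<longleftrightarrow> structurally_le M U W \<and> \<not> structurally_le M W U"

definition cut_distance_compatible ::
  "'a measure \<Rightarrow> (('a \<Rightarrow> 'a \<Rightarrow> real) \<Rightarrow> real) \<Rightarrow> bool" where
  "cut_distance_compatible M \<theta> \<longleftrightarrow>
     (\<forall>W\<^sub>1 W\<^sub>2. graphon M W\<^sub>1 \<longrightarrow> graphon M W\<^sub>2 \<longrightarrow>
        structurally_le M W\<^sub>1 W\<^sub>2 \<longrightarrow> \<theta> W\<^sub>1 \<le> \<theta> W\<^sub>2)"

definition cut_distance_identifying ::
  "'a measure \<Rightarrow> (('a \<Rightarrow> 'a \<Rightarrow> real) \<Rightarrow> real) \<Rightarrow> bool" where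
  "cut_distance_identifying M \<theta> \<longleftrightarrow>
     (\<forall>W\<^sub>1 W\<^sub>2. graphon M W\<^sub>1 \<longrightarrow> graphon M W\<^sub>2 \<longrightarrow>
        structurally_less M W\<^sub>1 W\<^sub>2 \<longrightarrow> \<theta> W\<^sub>1 < \<theta> W\<^sub>2)"

definition INT_param :: "'a measure \<Rightarrow> (real \<Rightarrow> real) \<Rightarrow> ('a \<Rightarrow> 'a \<Rightarrow> real) \<Rightarrow> real" where
  "INT_param M f W = (\<integral>x. (\<integral>y. f (W x y) \<partial>M) \<partial>M)"

definition strictly_convex_on :: "real set \<Rightarrow> (real \<Rightarrow> real) \<Rightarrow> bool" where
  "strictly_convex_on S f \<longleftrightarrow>
     convex S \<and>
     (\<forall>x\<in>S. \<forall>y\<in>S. \<forall>t. x \<noteq> y \<longrightarrow> 0 < t \<longrightarrow> t < 1 \<longrightarrow>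
        f ((1 - t) * x + t * y) < (1 - t) * f x + t * f y)"

end

theory Submission
  imports Defs
begin

text \<open>
  Let \<open>W\<^sub>1 \<preceq> W\<^sub>2\<close>, so that \<open>W\<^sub>2\<close> composed with suitable measure preserving bijections \<open>\<pi>\<^sub>n\<close> tends
  weak* to \<open>W\<^sub>1\<close>. Testing against the indicator of \<open>{W\<^sub>1 > t}\<close> shows that the gap
  \<open>p t = \<integral>(W\<^sub>2 - t)\<^sup>+ - \<integral>(W\<^sub>1 - t)\<^sup>+\<close> is nonnegative. A convex \<open>f\<close> is the pointwise limit on \<open>[0,1]\<close>
  of its piecewise linear interpolants, which are nonnegative combinations of hinges \<open>(x - t)\<^sup>+\<close>
  plus an affine function; hence \<open>INT\<^sub>f(W\<^sub>2) - INT\<^sub>f(W\<^sub>1)\<close> is a limit of nonnegative combinations of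
  values of \<open>p\<close>. If \<open>f\<close> is strictly convex and the two values agree, then \<open>p = 0\<close>, so \<open>W\<^sub>1\<close> and \<open>W\<^sub>2\<close>
  have equal second moments. This upgrades weak* convergence to convergence in \<open>L\<^sup>1\<close>, and then
  \<open>W\<^sub>1\<close> composed with the inverses of the \<open>\<pi>\<^sub>n\<close> converges to \<open>W\<^sub>2\<close>, which gives \<open>W\<^sub>2 \<preceq> W\<^sub>1\<close>.
\<close>

section \<open>Piecewise linear interpolation of convex functions\<close>

definition hinge :: "real \<Rightarrow> real \<Rightarrow> real" where
  "hinge t x = max 0 (x - t)"

text \<open>This is the change of slope of the interpolant at the node \<open>i / N\<close>; the
  factor \<open>N\<close> turns differences of values into differences of slopes. It is used for
  \<open>1 \<le> i\<close> only, where \<open>i - 1\<close> is not truncated.\<close>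

definition second_difference :: "(real \<Rightarrow> real) \<Rightarrow> nat \<Rightarrow> nat \<Rightarrow> real" where
  "second_difference f N i =
     N * (f (real (Suc i) / N) - 2 * f (real i / N) + f (real (i - 1) / N))"

text \<open>The interpolant of \<open>f\<close> at the nodes \<open>0, 1 / N, ..., 1\<close>: the
  line of the first cell, bent at each inner node by a hinge. In this form its expectation is a
  combination of the mean and of hinge expectations.\<close>

definition pl_interp :: "(real \<Rightarrow> real) \<Rightarrow> nat \<Rightarrow> real \<Rightarrow> real" where
  "pl_interp f N x = f 0 + N * (f (1 / N) - f 0) * x
     + (\<Sum>i\<in>{1..<N}. second_difference f N i * hinge (real i / N) x)"

lemma hinge_measurable [measurable]: "hinge t \<in> borel_measurable borel"
  unfolding hinge_def by measurable

lemma hinge_Lipschitz: "\<bar>hinge t x - hinge s x\<bar> \<le> \<bar>t - s\<bar>"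
  by (auto simp: hinge_def max_def)

text \<open>An identity of affine functions, valid for all \<open>x\<close>. Adding the slope change
  at the next node turns the line through two neighbouring nodes into the line over the following
  cell, so the sum telescopes.\<close>

lemma pl_partial_sum:
  assumes "0 < N"
  shows "f 0 + N * (f (1 / N) - f 0) * x
     + (\<Sum>i\<in>{1..<Suc k}. second_difference f N i * (x - real i / N))
     = f (real k / N) + N * (f (real (Suc k) / N) - f (real k / N)) * (x - real k / N)"
proof (induction k)
  case 0
  then show ?case by simp
next
  case (Suc k)
  have k: "real (Suc k) / N = real k / N + 1 / N"
    by (simp add: add_divide_distrib)
  let ?a = "f (real k / N)" and ?b = "f (real (Suc k) / N)" and ?c = "f (real (Suc (Suc k)) / N)"
  have "?a + N * (?b - ?a) * (x - real k / N)
      + N * (?c - 2 * ?b + ?a) * (x - real (Suc k) / N)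
      = ?b + N * (?c - ?b) * (x - real (Suc k) / N)"
    unfolding k using assms by (simp add: field_simps)
  then show ?case
    using Suc by (simp add: second_difference_def)
qed

text \<open>On cell \<open>k\<close> the hinges at nodes beyond \<open>k\<close> vanish and the
  others are linear, so the hinge sum becomes the partial sum above.\<close>

lemma pl_interp_eq:
  assumes "k < N" "real k / N \<le> x" "x \<le> real (Suc k) / N"
  shows "pl_interp f N x
    = f (real k / N) + (N * x - k) * (f (real (Suc k) / N) - f (real k / N))"
proof -
  have "(\<Sum>i\<in>{1..<N}. second_difference f N i * hinge (real i / N) x)
    = (\<Sum>i\<in>{1..<Suc k}. second_difference f N i * (x - real i / N))"
  proof (rule sum.mono_neutral_cong_right)
    show "\<forall>i\<in>{1..<N} - {1..<Suc k}. second_difference f N i * hinge (real i / N) x = 0"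
    proof
      fix i assume "i \<in> {1..<N} - {1..<Suc k}"
      then have "real (Suc k) / N \<le> real i / N"
        by (intro divide_right_mono) auto
      then show "second_difference f N i * hinge (real i / N) x = 0"
        using assms(3) by (simp add: hinge_def)
    qed
    show "second_difference f N i * hinge (real i / N) x = second_difference f N i * (x - real i / N)"
      if "i \<in> {1..<Suc k}" for i
    proof -
      have "real i / N \<le> real k / N"
        using that by (intro divide_right_mono) auto
      then show ?thesis
        using assms(2) by (simp add: hinge_def)
    qed
  qed (use assms(1) in auto)
  then have "pl_interp f N x
    = f (real k / N) + N * (f (real (Suc k) / N) - f (real k / N)) * (x - real k / N)"
    unfolding pl_interp_def using pl_partial_sum[of N f x k] assms(1) by simp
  also have "\<dots> = f (real k / N) + (N * x - k) * (f (real (Suc k) / N) - f (real k / N))"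
    using assms(1) by (simp add: field_simps)
  finally show ?thesis .
qed

text \<open>The only form in which the interpolant is estimated: its bound and its convergence both
  follow from averaging \<open>f\<close> over two nearby nodes.\<close>

lemma pl_interp_convex_combination:
  assumes "0 < N" "x \<in> {0..1}"
  obtains u v s where "u \<in> {0..1}" "v \<in> {0..1}" "s \<in> {0..1}"
    "\<bar>u - x\<bar> \<le> 1 / N" "\<bar>v - x\<bar> \<le> 1 / N"
    "pl_interp f N x = (1 - s) * f u + s * f v"
proof -
  \<comment> \<open>At \<open>x = 1\<close> the floor would be \<open>N\<close>, which is not the
    index of a cell; the last cell is taken instead.\<close>
  define k where "k = (if x = 1 then N - 1 else nat \<lfloor>N * x\<rfloor>)"
  have k: "k < N \<and> real k \<le> N * x \<and> N * x \<le> real (Suc k)"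
  proof (cases "x = 1")
    case True
    then show ?thesis using assms by (auto simp: k_def)
  next
    case False
    then have "N * x < N" "0 \<le> N * x"
      using assms by auto
    then show ?thesis
      using False unfolding k_def by simp linarith
  qed
  have le: "real k / N \<le> x" "x \<le> real (Suc k) / N"
    using k assms by (auto simp: field_simps)
  have Suc: "real (Suc k) / N = real k / N + 1 / N"
    by (simp add: add_divide_distrib)
  show ?thesis
  proof (rule that[of "real k / N" "real (Suc k) / N" "N * x - k"])
    show "\<bar>real k / N - x\<bar> \<le> 1 / N" "\<bar>real (Suc k) / N - x\<bar> \<le> 1 / N"
      using le Suc by linarith+
    show "pl_interp f N x
      = (1 - (N * x - k)) * f (real k / N) + (N * x - k) * f (real (Suc k) / N)"
      using pl_interp_eq[of k N x f] k le by (simp add: algebra_simps)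
  qed (use k assms in \<open>auto simp: field_simps\<close>)
qed

lemma pl_interp_at_0: "pl_interp f N 0 = f 0"
  by (simp add: pl_interp_def hinge_def)

lemma pl_interp_at_1: "0 < N \<Longrightarrow> pl_interp f N 1 = f 1"
  using pl_interp_eq[of "N - 1" N 1 f] by (simp add: of_nat_diff)

text \<open>The chord between the endpoints bounds \<open>f\<close> from above. Since
  \<open>1/2\<close> is the midpoint of \<open>x\<close> and \<open>1 - x\<close>, the upper bound
  at \<open>1 - x\<close> yields a lower bound at \<open>x\<close>.\<close>

lemma convex_on_unit_interval_bounded:
  fixes f :: "real \<Rightarrow> real"
  assumes "convex_on {0..1} f"
  obtains B where "\<And>x. x \<in> {0..1} \<Longrightarrow> \<bar>f x\<bar> \<le> B"
proof -
  define C where "C = max (f 0) (f 1)"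
  have up: "f x \<le> C" if "x \<in> {0..1}" for x
  proof -
    have "f ((1 - x) *\<^sub>R 0 + x *\<^sub>R 1) \<le> (1 - x) * f 0 + x * f 1"
      using that by (intro convex_onD[OF assms]) auto
    also have "\<dots> \<le> (1 - x) * C + x * C"
      using that by (intro add_mono mult_left_mono) (auto simp: C_def)
    finally show ?thesis by (simp add: algebra_simps)
  qed
  have low: "2 * f (1/2) - C \<le> f x" if "x \<in> {0..1}" for x
  proof -
    have eq: "(1 - 1/2) *\<^sub>R x + (1/2) *\<^sub>R (1 - x) = 1/2"
      by (simp add: diff_divide_distrib)
    have "f ((1 - 1/2) *\<^sub>R x + (1/2) *\<^sub>R (1 - x)) \<le> (1 - 1/2) * f x + (1/2) * f (1 - x)"
      using that by (intro convex_onD[OF assms]) auto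
    moreover have "f (1 - x) \<le> C"
      using that by (intro up) auto
    ultimately show ?thesis
      unfolding eq by simp
  qed
  show ?thesis
    by (rule that[of "\<bar>C\<bar> + \<bar>2 * f (1/2) - C\<bar>"]) (use up low in \<open>fastforce simp: abs_le_iff\<close>)
qed

lemma pl_interp_bounded:
  assumes "\<And>x. x \<in> {0..1} \<Longrightarrow> \<bar>f x\<bar> \<le> B" "0 < N" "x \<in> {0..1}"
  shows "\<bar>pl_interp f N x\<bar> \<le> B"
proof -
  obtain u v s where *: "u \<in> {0..1}" "v \<in> {0..1}" "s \<in> {0..1}"
    "pl_interp f N x = (1 - s) * f u + s * f v"
    using pl_interp_convex_combination[OF assms(2,3), where f = f] by blast
  have "\<bar>pl_interp f N x\<bar> \<le> \<bar>(1 - s) * f u\<bar> + \<bar>s * f v\<bar>"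
    unfolding * by (rule abs_triangle_ineq)
  also have "\<dots> \<le> (1 - s) * B + s * B"
    using * assms(1) by (auto simp: abs_mult intro!: add_mono mult_left_mono)
  finally show ?thesis by (simp add: algebra_simps)
qed

text \<open>The endpoints are nodes of every interpolant, so a jump of \<open>f\<close> there does no harm.\<close>

lemma pl_interp_tendsto:
  assumes "convex_on {0..1} f" "x \<in> {0..1}"
  shows "(\<lambda>N. pl_interp f N x) \<longlonglongrightarrow> f x"
proof -
  consider "x = 0" | "x = 1" | "x \<in> {0<..<1}"
    using assms(2) by force
  then show ?thesis
  proof cases
    case 1
    then show ?thesis by (simp add: pl_interp_at_0)
  next
    case 2
    have "eventually (\<lambda>N. pl_interp f N x = f x) sequentially"
      using eventually_gt_at_top[of 0] by eventually_elim (simp add: 2 pl_interp_at_1)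
    then show ?thesis by (rule tendsto_eventually)
  next
    case 3
    have "continuous_on {0<..<1} f"
      by (intro convex_on_continuous convex_on_subset[OF assms(1)]) auto
    then have cont: "isCont f x"
      using 3 continuous_on_eq_continuous_at[of "{0<..<1}" f] by auto
    show ?thesis
    proof (rule LIMSEQ_I)
      fix e :: real assume "0 < e"
      then obtain d where d: "0 < d" "\<And>y. \<bar>y - x\<bar> < d \<Longrightarrow> \<bar>f y - f x\<bar> < e"
        using cont unfolding continuous_at_real_range by auto
      obtain N0 :: nat where N0: "0 < N0" "1 / N0 < d"
        using d(1) ex_inverse_of_nat_less[of d] by (auto simp: inverse_eq_divide)
      show "\<exists>N0. \<forall>N\<ge>N0. norm (pl_interp f N x - f x) < e"
      proof (intro exI allI impI)
        fix N assume N: "N0 \<le> N"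
        then have "0 < N" using N0 by simp
        have "1 / real N \<le> 1 / N0"
          using N N0 by (intro divide_left_mono) auto
        then have small: "1 / real N < d" using N0 by simp
        obtain u v s where *: "s \<in> {0..1}" "\<bar>u - x\<bar> \<le> 1 / N" "\<bar>v - x\<bar> \<le> 1 / N"
          "pl_interp f N x = (1 - s) * f u + s * f v"
          using pl_interp_convex_combination[OF \<open>0 < N\<close> assms(2), where f = f] by blast
        have uv: "\<bar>f u - f x\<bar> < e" "\<bar>f v - f x\<bar> < e"
          using * small by (auto intro!: d(2))
        have "pl_interp f N x - f x = (1 - s) * (f u - f x) + s * (f v - f x)"
          unfolding * by (simp add: algebra_simps)
        moreover have "\<bar>(1 - s) * (f u - f x) + s * (f v - f x)\<bar> < e"
          using convex_bound_lt[of "\<bar>f u - f x\<bar>" e "\<bar>f v - f x\<bar>" "1 - s" s] uv *(1)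
            abs_triangle_ineq[of "(1 - s) * (f u - f x)" "s * (f v - f x)"]
          by (simp add: abs_mult)
        ultimately show "norm (pl_interp f N x - f x) < e" by simp
      qed
    qed
  qed
qed

text \<open>Midpoint convexity at \<open>i / N\<close>; the range of \<open>i\<close> keeps both
  neighbouring nodes in the unit interval.\<close>

lemma second_difference_nonneg:
  assumes "convex_on {0..1} f" "i \<in> {1..<N}"
  shows "0 \<le> second_difference f N i"
proof -
  let ?a = "real (i - 1) / N" and ?b = "real (Suc i) / N"
  have "f ((1 - 1/2) *\<^sub>R ?a + (1/2) *\<^sub>R ?b) \<le> (1 - 1/2) * f ?a + (1/2) * f ?b"
    using assms(2) by (intro convex_onD[OF assms(1)]) (auto simp: field_simps)
  moreover have "(1 - 1/2) *\<^sub>R ?a + (1/2) *\<^sub>R ?b = real i / N"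
    using assms(2) by (simp add: field_simps of_nat_diff)
  ultimately show ?thesis
    unfolding second_difference_def by (intro mult_nonneg_nonneg) auto
qed

text \<open>As a function of the knot \<open>t\<close>, the second difference of the hinge around
  \<open>c\<close> is a hat of height \<open>e\<close>. Thus a sum of hats weighted by second
  differences of \<open>f\<close> can be evaluated through three values of the interpolant.\<close>

lemma hinge_hat:
  assumes "0 \<le> e"
  shows "hinge t (c - e) + hinge t (c + e) - 2 * hinge t c = max 0 (e - \<bar>t - c\<bar>)"
  using assms by (auto simp: hinge_def max_def abs_if)

lemma strictly_convex_imp_convex_on:
  assumes "strictly_convex_on S f"
  shows "convex_on S f"
proof (rule convex_onI)
  show "convex S" using assms by (simp add: strictly_convex_on_def)
  fix u x y assume *: "0 < u" "u < (1::real)" "x \<in> S" "y \<in> S"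
  show "f ((1 - u) *\<^sub>R x + u *\<^sub>R y) \<le> (1 - u) * f x + u * f y"
  proof (cases "x = y")
    case True
    then show ?thesis by (simp add: algebra_simps)
  next
    case False
    then show ?thesis
      using assms * by (simp add: strictly_convex_on_def less_imp_le)
  qed
qed

section \<open>Convex order of random variables\<close>

lemma pl_interp_measurable [measurable]: "pl_interp f N \<in> borel_measurable borel"
  unfolding pl_interp_def by measurable

context prob_space
begin

lemma integrable_hinge:
  assumes [measurable]: "X \<in> borel_measurable M" and "\<And>x. x \<in> space M \<Longrightarrow> X x \<in> {0..1::real}"
  shows "integrable M (\<lambda>x. hinge t (X x))"
  by (rule integrable_const_bound[where B = "1 + \<bar>t\<bar>"])
     (use assms(2) in \<open>auto intro!: AE_I2 simp: hinge_def\<close>, fastforce)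

text \<open>Measurability comes from the interpolants as a pointwise limit, which covers jumps of
  \<open>f\<close> at the endpoints; integrability then follows from boundedness.\<close>

lemma convex_comp_integrable:
  assumes [measurable]: "X \<in> borel_measurable M" and X: "\<And>x. x \<in> space M \<Longrightarrow> X x \<in> {0..1::real}"
    and f: "convex_on {0..1} f"
  shows "integrable M (\<lambda>x. f (X x))"
proof -
  obtain B where B: "\<And>x. x \<in> {0..1} \<Longrightarrow> \<bar>f x\<bar> \<le> B"
    using convex_on_unit_interval_bounded[OF f] by blast
  have "(\<lambda>x. f (X x)) \<in> borel_measurable M"
    by (rule borel_measurable_LIMSEQ_real[where u = "\<lambda>N x. pl_interp f N (X x)"])
       (use X f in \<open>auto intro: pl_interp_tendsto\<close>)
  then show ?thesis
    by (rule integrable_const_bound[rotated, where B = B]) (use B X in \<open>auto intro!: AE_I2\<close>)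
qed

lemma expectation_pl_interp_tendsto:
  assumes [measurable]: "X \<in> borel_measurable M" and X: "\<And>x. x \<in> space M \<Longrightarrow> X x \<in> {0..1::real}"
    and f: "convex_on {0..1} f"
  shows "(\<lambda>N. expectation (\<lambda>x. pl_interp f N (X x))) \<longlonglongrightarrow> expectation (\<lambda>x. f (X x))"
proof -
  obtain B where B: "\<And>x. x \<in> {0..1} \<Longrightarrow> \<bar>f x\<bar> \<le> B"
    using convex_on_unit_interval_bounded[OF f] by blast
  \<comment> \<open>The shift to \<open>Suc N\<close> makes the uniform bound on the interpolants
    available for every index.\<close>
  have "(\<lambda>N. expectation (\<lambda>x. pl_interp f (Suc N) (X x))) \<longlonglongrightarrow> expectation (\<lambda>x. f (X x))"
  proof (rule integral_dominated_convergence[where w = "\<lambda>_. B"])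
    show "(\<lambda>x. f (X x)) \<in> borel_measurable M"
      using convex_comp_integrable[OF assms] by auto
    show "AE x in M. (\<lambda>N. pl_interp f (Suc N) (X x)) \<longlonglongrightarrow> f (X x)"
      by (intro AE_I2 LIMSEQ_Suc pl_interp_tendsto f X)
    show "AE x in M. norm (pl_interp f (Suc N) (X x)) \<le> B" for N
      using pl_interp_bounded[OF B] X by (intro AE_I2) auto
  qed auto
  then show ?thesis by (rule LIMSEQ_imp_Suc)
qed

text \<open>Together with equal means, nonnegativity of this gap for all \<open>t\<close> says that
  \<open>Y\<close> dominates \<open>X\<close> in the convex order.\<close>

definition hinge_gap :: "('a \<Rightarrow> real) \<Rightarrow> ('a \<Rightarrow> real) \<Rightarrow> real \<Rightarrow> real" where
  "hinge_gap X Y t = expectation (\<lambda>x. hinge t (Y x)) - expectation (\<lambda>x. hinge t (X x))"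

text \<open>Equal means cancel the affine parts of the interpolants, so only hinges weighted by
  second differences remain.\<close>

lemma convex_gap_tendsto:
  assumes [measurable]: "X \<in> borel_measurable M" "Y \<in> borel_measurable M"
    and X: "\<And>x. x \<in> space M \<Longrightarrow> X x \<in> {0..1}" and Y: "\<And>x. x \<in> space M \<Longrightarrow> Y x \<in> {0..1}"
    and eq: "expectation X = expectation Y"
    and f: "convex_on {0..1} f"
  shows "(\<lambda>N. \<Sum>i\<in>{1..<N}. second_difference f N i * hinge_gap X Y (real i / N))
    \<longlonglongrightarrow> expectation (\<lambda>x. f (Y x)) - expectation (\<lambda>x. f (X x))"
proof -
  have *: "expectation (\<lambda>x. pl_interp f N (Z x)) = f 0 + N * (f (1 / N) - f 0) * expectation Z
      + (\<Sum>i\<in>{1..<N}. second_difference f N i * expectation (\<lambda>x. hinge (real i / N) (Z x)))"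
    if [measurable]: "Z \<in> borel_measurable M" and Z: "\<And>x. x \<in> space M \<Longrightarrow> Z x \<in> {0..1}" for Z N
  proof -
    have [simp]: "integrable M Z"
      using convex_comp_integrable[of Z "\<lambda>x. x"] Z by (simp add: convex_on_def convex_real_interval)
    have [simp]: "integrable M (\<lambda>x. hinge t (Z x))" for t
      using that by (rule integrable_hinge)
    show ?thesis
      by (simp add: pl_interp_def prob_space)
  qed
  have "(\<lambda>N. expectation (\<lambda>x. pl_interp f N (Y x)) - expectation (\<lambda>x. pl_interp f N (X x)))
    \<longlonglongrightarrow> expectation (\<lambda>x. f (Y x)) - expectation (\<lambda>x. f (X x))"
    by (intro tendsto_diff expectation_pl_interp_tendsto X Y f) auto
  moreover have "expectation (\<lambda>x. pl_interp f N (Y x)) - expectation (\<lambda>x. pl_interp f N (X x))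
    = (\<Sum>i\<in>{1..<N}. second_difference f N i * hinge_gap X Y (real i / N))" for N
    using *[of X N] *[of Y N] X Y eq
    by (simp add: hinge_gap_def right_diff_distrib sum_subtractf)
  ultimately show ?thesis by simp
qed

text \<open>The approximating sums are nonnegative term by term; their nodes are inner ones, so the
  gap matters only on the open interval.\<close>

lemma expectation_convex_mono:
  assumes "X \<in> borel_measurable M" "Y \<in> borel_measurable M"
    and "\<And>x. x \<in> space M \<Longrightarrow> X x \<in> {0..1}" "\<And>x. x \<in> space M \<Longrightarrow> Y x \<in> {0..1}"
    and "expectation X = expectation Y"
    and gap: "\<And>t. t \<in> {0<..<1} \<Longrightarrow> 0 \<le> hinge_gap X Y t"
    and f: "convex_on {0..1} f"
  shows "expectation (\<lambda>x. f (X x)) \<le> expectation (\<lambda>x. f (Y x))"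
proof -
  have "0 \<le> expectation (\<lambda>x. f (Y x)) - expectation (\<lambda>x. f (X x))"
    by (rule LIMSEQ_le_const[OF convex_gap_tendsto[OF assms(1-5) f]])
       (auto intro!: sum_nonneg mult_nonneg_nonneg gap second_difference_nonneg f)
  then show ?thesis by simp
qed

text \<open>Each of the two expectations is 1-Lipschitz in the knot. This spreads positivity of the
  gap at one point to a neighbourhood.\<close>

lemma hinge_gap_Lipschitz:
  assumes "X \<in> borel_measurable M" "Y \<in> borel_measurable M"
    and "\<And>x. x \<in> space M \<Longrightarrow> X x \<in> {0..1}" "\<And>x. x \<in> space M \<Longrightarrow> Y x \<in> {0..1}"
  shows "\<bar>hinge_gap X Y t - hinge_gap X Y s\<bar> \<le> 2 * \<bar>t - s\<bar>"
proof -
  have *: "\<bar>expectation (\<lambda>x. hinge t (Z x)) - expectation (\<lambda>x. hinge s (Z x))\<bar> \<le> \<bar>t - s\<bar>"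
    if "Z \<in> borel_measurable M" and "\<And>x. x \<in> space M \<Longrightarrow> Z x \<in> {0..1}" for Z
  proof -
    note int = integrable_hinge[OF that]
    have "\<bar>expectation (\<lambda>x. hinge t (Z x)) - expectation (\<lambda>x. hinge s (Z x))\<bar>
      = \<bar>expectation (\<lambda>x. hinge t (Z x) - hinge s (Z x))\<bar>"
      by (simp add: int)
    also have "\<dots> \<le> expectation (\<lambda>x. \<bar>hinge t (Z x) - hinge s (Z x)\<bar>)"
      by (rule integral_abs_bound)
    also have "\<dots> \<le> expectation (\<lambda>x. \<bar>t - s\<bar>)"
      by (intro integral_mono integrable_abs Bochner_Integration.integrable_diff int)
         (auto simp: hinge_Lipschitz)
    finally show ?thesis by (simp add: prob_space)
  qed
  show ?thesis
    unfolding hinge_gap_def using *[of X] *[of Y] assms by (smt (verit))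
qed

text \<open>
  If the gap is positive at \<open>c\<close>, it dominates a hat function \<open>t \<mapsto> max 0 (e - \<bar>t - c\<bar>)\<close>, whose
  sum against the second differences of \<open>f\<close> is \<open>f (c - e) + f (c + e) - 2 f c > 0\<close> in the limit.
\<close>

lemma hinge_gap_eq_0:
  assumes "X \<in> borel_measurable M" "Y \<in> borel_measurable M"
    and "\<And>x. x \<in> space M \<Longrightarrow> X x \<in> {0..1}" "\<And>x. x \<in> space M \<Longrightarrow> Y x \<in> {0..1}"
    and "expectation X = expectation Y"
    and gap: "\<And>t. t \<in> {0<..<1} \<Longrightarrow> 0 \<le> hinge_gap X Y t"
    and f: "strictly_convex_on {0..1} f"
    and le: "expectation (\<lambda>x. f (Y x)) \<le> expectation (\<lambda>x. f (X x))"
    and c: "c \<in> {0<..<1}"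
  shows "hinge_gap X Y c = 0"
proof (rule ccontr)
  assume "hinge_gap X Y c \<noteq> 0"
  then have pos: "0 < hinge_gap X Y c"
    using gap[OF c] by simp
  note cf = strictly_convex_imp_convex_on[OF f]
  \<comment> \<open>Half the gap at \<open>c\<close> compensates for the Lipschitz constant 2, so
    that a hat of height \<open>e\<close> fits below the gap; the other two bounds keep
    \<open>c - e\<close> and \<open>c + e\<close> in the unit interval.\<close>
  define e where "e = Min {hinge_gap X Y c / 2, c, 1 - c}"
  have e: "0 < e" "2 * e \<le> hinge_gap X Y c" "e \<le> c" "e \<le> 1 - c"
    using pos c by (auto simp: e_def min_def)
  have hat: "max 0 (e - \<bar>t - c\<bar>) \<le> hinge_gap X Y t" if "t \<in> {0<..<1}" for t
    using gap[OF that] hinge_gap_Lipschitz[OF assms(1-4), of c t] e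
    by (auto simp: max_def abs_if split: if_splits)
  \<comment> \<open>The affine part of the interpolant has zero second difference, so only the hinge
    sums contribute.\<close>
  have sum_hat: "(\<Sum>i\<in>{1..<N}. second_difference f N i * max 0 (e - \<bar>real i / N - c\<bar>))
    = pl_interp f N (c - e) + pl_interp f N (c + e) - 2 * pl_interp f N c" for N
  proof -
    have "(\<Sum>i\<in>{1..<N}. second_difference f N i * max 0 (e - \<bar>real i / N - c\<bar>))
      = (\<Sum>i\<in>{1..<N}. second_difference f N i * hinge (real i / N) (c - e))
        + (\<Sum>i\<in>{1..<N}. second_difference f N i * hinge (real i / N) (c + e))
        - 2 * (\<Sum>i\<in>{1..<N}. second_difference f N i * hinge (real i / N) c)"
      using hinge_hat[of e _ c] e(1)
      by (simp add: sum_distrib_left flip: sum.distrib sum_subtractf)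
         (simp add: algebra_simps flip: hinge_hat)
    then show ?thesis
      by (simp add: pl_interp_def algebra_simps)
  qed
  have "(\<lambda>N. \<Sum>i\<in>{1..<N}. second_difference f N i * max 0 (e - \<bar>real i / N - c\<bar>))
    \<longlonglongrightarrow> f (c - e) + f (c + e) - 2 * f c"
    unfolding sum_hat by (intro tendsto_intros pl_interp_tendsto cf) (use e c in auto)
  moreover have "(\<Sum>i\<in>{1..<N}. second_difference f N i * max 0 (e - \<bar>real i / N - c\<bar>))
    \<le> (\<Sum>i\<in>{1..<N}. second_difference f N i * hinge_gap X Y (real i / N))" for N
    by (intro sum_mono mult_left_mono second_difference_nonneg cf hat) auto
  ultimately have "f (c - e) + f (c + e) - 2 * f c
      \<le> expectation (\<lambda>x. f (Y x)) - expectation (\<lambda>x. f (X x))"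
    by (intro LIMSEQ_le[OF _ convex_gap_tendsto[OF assms(1-5) cf]]) auto
  moreover have "f ((1 - 1/2) * (c - e) + (1/2) * (c + e)) < (1 - 1/2) * f (c - e) + (1/2) * f (c + e)"
  proof -
    have "c - e \<in> {0..1}" "c + e \<in> {0..1}" "c - e \<noteq> c + e"
      using e c by auto
    moreover have "0 < (1/2::real)" "(1/2::real) < 1"
      by simp_all
    ultimately show ?thesis
      using f unfolding strictly_convex_on_def by blast
  qed
  moreover have "(1 - 1/2) * (c - e) + (1/2) * (c + e) = c"
    by (simp add: field_simps)
  ultimately show False
    using le by simp
qed

lemma convex_on_power2_unit: "convex_on {0..1::real} (\<lambda>x. x\<^sup>2)"
  by (rule convex_on_subset[OF convex_power2]) auto

text \<open>A vanishing gap is symmetric in \<open>X\<close> and \<open>Y\<close>, so monotonicity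
  applies to the square in both directions.\<close>

lemma expectation_power2_eq:
  assumes "X \<in> borel_measurable M" "Y \<in> borel_measurable M"
    and "\<And>x. x \<in> space M \<Longrightarrow> X x \<in> {0..1}" "\<And>x. x \<in> space M \<Longrightarrow> Y x \<in> {0..1}"
    and "expectation X = expectation Y"
    and "\<And>t. t \<in> {0<..<1} \<Longrightarrow> 0 \<le> hinge_gap X Y t"
    and "strictly_convex_on {0..1} f"
    and "expectation (\<lambda>x. f (Y x)) \<le> expectation (\<lambda>x. f (X x))"
  shows "expectation (\<lambda>x. (X x)\<^sup>2) = expectation (\<lambda>x. (Y x)\<^sup>2)"
proof -
  have zero: "hinge_gap X Y t = 0" if "t \<in> {0<..<1}" for t
    using hinge_gap_eq_0[OF assms that] .
  have zero': "hinge_gap Y X t = 0" if "t \<in> {0<..<1}" for t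
    using zero[OF that] by (simp add: hinge_gap_def)
  show ?thesis
    using expectation_convex_mono[OF assms(1-6) convex_on_power2_unit]
      expectation_convex_mono[OF assms(2,1,4,3) assms(5)[symmetric] _ convex_on_power2_unit] zero'
    by (simp add: antisym)
qed

section \<open>Testing bounded sequences against integrable functions\<close>

lemma integrable_mult_bounded:
  fixes D h :: "'a \<Rightarrow> real"
  assumes "D \<in> borel_measurable M" and "\<And>x. x \<in> space M \<Longrightarrow> \<bar>D x\<bar> \<le> 1"
    and "integrable M h"
  shows "integrable M (\<lambda>x. h x * D x)"
  by (rule Bochner_Integration.integrable_bound[OF assms(3)])
     (use assms in \<open>auto intro!: AE_I2 mult_left_le simp: abs_mult\<close>)

text \<open>Since \<open>D n\<close> is bounded by 1 uniformly in \<open>n\<close>, replacing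
  \<open>g\<close> by \<open>s i\<close> costs at most their L1 distance for all \<open>n\<close> at
  once.\<close>

lemma tendsto_integral_mult_L1_closed:
  fixes D :: "nat \<Rightarrow> 'a \<Rightarrow> real"
  assumes [measurable]: "\<And>n. D n \<in> borel_measurable M"
    and D: "\<And>n x. x \<in> space M \<Longrightarrow> \<bar>D n x\<bar> \<le> 1"
    and s: "\<And>i. integrable M (s i)" and g: "integrable M g"
    and lim: "(\<lambda>i. expectation (\<lambda>x. \<bar>g x - s i x\<bar>)) \<longlonglongrightarrow> 0"
    and conv: "\<And>i. (\<lambda>n. expectation (\<lambda>x. s i x * D n x)) \<longlonglongrightarrow> 0"
  shows "(\<lambda>n. expectation (\<lambda>x. g x * D n x)) \<longlonglongrightarrow> 0"
proof (rule LIMSEQ_I)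
  have int: "integrable M (\<lambda>x. h x * D n x)" if "integrable M h" for h n
    by (rule integrable_mult_bounded[OF assms(1) D that])
  fix e :: real assume "0 < e"
  then obtain i where i: "expectation (\<lambda>x. \<bar>g x - s i x\<bar>) < e / 2"
    using LIMSEQ_D[OF lim, of "e / 2"] by auto
  obtain n0 where n0: "\<And>n. n0 \<le> n \<Longrightarrow> \<bar>expectation (\<lambda>x. s i x * D n x)\<bar> < e / 2"
    using LIMSEQ_D[OF conv[of i], of "e / 2"] \<open>0 < e\<close> by auto
  show "\<exists>n0. \<forall>n\<ge>n0. norm (expectation (\<lambda>x. g x * D n x) - 0) < e"
  proof (intro exI allI impI)
    fix n assume "n0 \<le> n"
    have d: "integrable M (\<lambda>x. g x - s i x)" using g s by auto
    have "expectation (\<lambda>x. g x * D n x)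
      = expectation (\<lambda>x. (g x - s i x) * D n x) + expectation (\<lambda>x. s i x * D n x)"
      using Bochner_Integration.integral_add[OF int[OF d, of n] int[OF s, of i n]]
      by (simp add: left_diff_distrib)
    moreover have "\<bar>expectation (\<lambda>x. (g x - s i x) * D n x)\<bar> \<le> expectation (\<lambda>x. \<bar>g x - s i x\<bar>)"
    proof -
      have "\<bar>expectation (\<lambda>x. (g x - s i x) * D n x)\<bar> \<le> expectation (\<lambda>x. \<bar>(g x - s i x) * D n x\<bar>)"
        by (rule integral_abs_bound)
      also have "\<dots> \<le> expectation (\<lambda>x. \<bar>g x - s i x\<bar>)"
        using D by (intro integral_mono integrable_abs int d) (auto intro!: mult_left_le simp: abs_mult)
      finally show ?thesis .
    qed
    ultimately show "norm (expectation (\<lambda>x. g x * D n x) - 0) < e"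
      using i n0[OF \<open>n0 \<le> n\<close>] by simp
  qed
qed

text \<open>The sets whose indicators pass the test form a Dynkin system, with
  \<open>space M \<in> G\<close> serving the complements. Linearity and closure in L1 then lead from
  indicators to all integrable functions.\<close>

lemma tendsto_integral_mult_of_generator:
  fixes D :: "nat \<Rightarrow> 'a \<Rightarrow> real"
  assumes [measurable]: "\<And>n. D n \<in> borel_measurable M"
    and D: "\<And>n x. x \<in> space M \<Longrightarrow> \<bar>D n x\<bar> \<le> 1"
    and G: "Int_stable G" "G \<subseteq> Pow (space M)" "sets M = sigma_sets (space M) G" "space M \<in> G"
    and conv: "\<And>A. A \<in> G \<Longrightarrow> (\<lambda>n. expectation (\<lambda>x. indicator A x * D n x)) \<longlonglongrightarrow> 0"
    and g: "integrable M g"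
  shows "(\<lambda>n. expectation (\<lambda>x. g x * D n x)) \<longlonglongrightarrow> 0"
proof -
  have int: "integrable M (\<lambda>x. h x * D n x)" if "integrable M h" for h n
    by (rule integrable_mult_bounded[OF assms(1) D that])
  have ind: "(\<lambda>n. expectation (\<lambda>x. indicator A x * D n x)) \<longlonglongrightarrow> 0" if "A \<in> sets M" for A
  proof -
    have "A \<in> sigma_sets (space M) G" using that G(3) by simp
    from G(1,2) this show ?thesis
    proof (induction rule: sigma_sets_induct_disjoint)
      case (basic A)
      then show ?case by (rule conv)
    next
      case empty
      then show ?case by simp
    next
      case (compl A)
      then have [measurable]: "A \<in> sets M" using G(3) by simp
      have "expectation (\<lambda>x. indicator (space M - A) x * D n x)
        = expectation (\<lambda>x. indicator (space M) x * D n x) - expectation (\<lambda>x. indicator A x * D n x)" for n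
        by (subst Bochner_Integration.integral_diff[symmetric])
           (auto intro!: int integrable_real_indicator Bochner_Integration.integral_cong
             simp: emeasure_eq_measure split: split_indicator)
      then show ?case
        using tendsto_diff[OF conv[OF G(4)] compl(2)] by simp
    next
      case (union A)
      then have [measurable]: "A i \<in> sets M" for i using G(3) by auto
      \<comment> \<open>By dominated convergence these partial sums tend in L1 to the indicator of
        the union, so the closure lemma applies.\<close>
      let ?s = "\<lambda>k x. \<Sum>i<k. indicator (A i) x :: real"
      have s: "?s k x = indicator (\<Union>i<k. A i) x" for k x
        using union(1) by (intro indicator_UN_disjoint[symmetric])
          (auto simp: disjoint_family_on_def)
      show ?case
      proof (rule tendsto_integral_mult_L1_closed[where s = ?s])
        show "(\<lambda>k. expectation (\<lambda>x. \<bar>indicator (\<Union>i. A i) x - ?s k x\<bar>)) \<longlonglongrightarrow> 0"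
        proof -
          have "(\<lambda>k. expectation (\<lambda>x. \<bar>indicator (\<Union>i. A i) x - ?s k x\<bar>)) \<longlonglongrightarrow> expectation (\<lambda>x. 0)"
          proof (rule integral_dominated_convergence[where w = "\<lambda>_. 1"])
            show "AE x in M. (\<lambda>k. \<bar>indicator (\<Union>i. A i) x - ?s k x\<bar>) \<longlonglongrightarrow> 0"
            proof (rule AE_I2)
              fix x
              have "(\<lambda>k. \<bar>indicator (\<Union>i. A i) x - indicator (\<Union>i<k. A i) x\<bar>)
                  \<longlonglongrightarrow> \<bar>indicator (\<Union>i. A i) x - indicator (\<Union>i. A i) x :: real\<bar>"
                by (intro tendsto_intros LIMSEQ_indicator_UN)
              then show "(\<lambda>k. \<bar>indicator (\<Union>i. A i) x - ?s k x\<bar>) \<longlonglongrightarrow> 0"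
                by (simp add: s)
            qed
          qed (auto simp: s split: split_indicator intro!: AE_I2)
          then show ?thesis by simp
        qed
        show "(\<lambda>n. expectation (\<lambda>x. ?s k x * D n x)) \<longlonglongrightarrow> 0" for k
        proof -
          have "expectation (\<lambda>x. ?s k x * D n x) 
            = (\<Sum>i<k. expectation (\<lambda>x. indicator (A i) x * D n x))" for n
            by (subst Bochner_Integration.integral_sum[symmetric])
               (auto intro!: int integrable_real_indicator simp: sum_distrib_right emeasure_eq_measure)
          moreover have "(\<lambda>n. \<Sum>i<k. expectation (\<lambda>x. indicator (A i) x * D n x)) \<longlonglongrightarrow> (\<Sum>i<k. 0)"
            by (rule tendsto_sum[OF union(3)])
          ultimately show ?thesis by simp
        qed
      qed (use D in \<open>auto intro!: integrable_real_indicator simp: emeasure_eq_measure\<close>)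
    qed
  qed
  show ?thesis
    using g
  proof (induction rule: integrable_induct)
    case (base A c)
    have "expectation (\<lambda>x. (indicator A x *\<^sub>R c) * D n x)
      = c * expectation (\<lambda>x. indicator A x * D n x)" for n
      by (subst integral_mult_right_zero[symmetric]) (auto simp: mult_ac)
    then show ?case
      using tendsto_mult_right_zero[OF ind[OF base(1)]] by simp
  next
    case (add f g)
    have "expectation (\<lambda>x. (f x + g x) * D n x)
      = expectation (\<lambda>x. f x * D n x) + expectation (\<lambda>x. g x * D n x)" for n
      using int[OF add.hyps(1)] int[OF add.hyps(2)] by (simp add: distrib_right)
    then show ?case
      using tendsto_add[OF add.IH] by simp
  next
    case (lim f s)
    show ?case
    proof (rule tendsto_integral_mult_L1_closed[where s = s])
      have "(\<lambda>i. expectation (\<lambda>x. \<bar>f x - s i x\<bar>)) \<longlonglongrightarrow> expectation (\<lambda>x. 0)"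
      \<comment> \<open>The induction rule provides
        \<open>norm (s i x) \<le> 2 * norm (f x)\<close>, whence the factor 3.\<close>
      proof (rule integral_dominated_convergence[where w = "\<lambda>x. 3 * norm (f x)"])
        show "AE x in M. (\<lambda>i. \<bar>f x - s i x\<bar>) \<longlonglongrightarrow> 0"
        proof (rule AE_I2)
          fix x assume "x \<in> space M"
          then have "(\<lambda>i. \<bar>f x - s i x\<bar>) \<longlonglongrightarrow> \<bar>f x - f x\<bar>"
            by (intro tendsto_intros lim)
          then show "(\<lambda>i. \<bar>f x - s i x\<bar>) \<longlonglongrightarrow> 0" by simp
        qed
        show "AE x in M. norm \<bar>f x - s i x\<bar> \<le> 3 * norm (f x)" for i
        proof (rule AE_I2)
          fix x assume "x \<in> space M"
          then have "norm (s i x) \<le> 2 * norm (f x)" by (rule lim)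
          then show "norm \<bar>f x - s i x\<bar> \<le> 3 * norm (f x)"
            using abs_triangle_ineq4[of "f x" "s i x"] by simp
        qed
      qed (use lim in auto)
      then show "(\<lambda>i. expectation (\<lambda>x. \<bar>f x - s i x\<bar>)) \<longlonglongrightarrow> 0" by simp
    qed (use lim D in auto)
  qed
qed

end

section \<open>Measure preserving bijections\<close>

text \<open>An explicit inverse and invariance under \<open>distr\<close> replace
  \<open>inv_into\<close> and preimages, which reduces inverses and compositions to computations
  with image measures.\<close>

lemma mp_bijectionI:
  assumes \<phi>: "\<phi> \<in> measurable M M" and \<psi>: "\<psi> \<in> measurable M M"
    and inv: "\<And>x. x \<in> space M \<Longrightarrow> \<psi> (\<phi> x) = x" "\<And>x. x \<in> space M \<Longrightarrow> \<phi> (\<psi> x) = x"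
    and mp: "distr M M \<phi> = M"
  shows "mp_bijection M \<phi>"
  unfolding mp_bijection_def
proof (intro conjI ballI)
  show bij: "bij_betw \<phi> (space M) (space M)"
    using inv \<phi> \<psi> by (intro bij_betw_byWitness[where f' = \<psi>]) (auto dest: measurable_space)
  show "\<phi> \<in> measurable M M" by fact
  have "inv_into (space M) \<phi> x = \<psi> x" if "x \<in> space M" for x
    using bij that inv \<psi> by (metis bij_betw_inv_into_left measurable_space)
  then show "inv_into (space M) \<phi> \<in> measurable M M"
    using \<psi> by (subst measurable_cong) auto
  show "emeasure M (\<phi> -` A \<inter> space M) = emeasure M A" if "A \<in> sets M" for A
    using emeasure_distr[OF \<phi> that] mp by simp
qed

lemma mp_bijection_measurable [measurable_dest]: "mp_bijection M \<phi> \<Longrightarrow> \<phi> \<in> measurable M M"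
  by (simp add: mp_bijection_def)

lemma mp_bijection_distr: "mp_bijection M \<phi> \<Longrightarrow> distr M M \<phi> = M"
  by (intro measure_eqI) (auto simp: mp_bijection_def emeasure_distr)

lemma mp_bijection_inverse_cancel:
  assumes "mp_bijection M \<phi>" "x \<in> space M"
  shows "inv_into (space M) \<phi> (\<phi> x) = x" "\<phi> (inv_into (space M) \<phi> x) = x"
  using assms by (auto simp: mp_bijection_def bij_betw_inv_into_left bij_betw_inv_into_right)

lemma mp_bijection_inv_into_measurable:
  "mp_bijection M \<phi> \<Longrightarrow> inv_into (space M) \<phi> \<in> measurable M M"
  by (simp add: mp_bijection_def)

lemma mp_bijection_id: "mp_bijection M (\<lambda>x. x)"
  by (rule mp_bijectionI[where \<psi> = "\<lambda>x. x"]) (auto simp: distr_id2)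

lemma mp_bijection_inv_into:
  assumes "mp_bijection M \<phi>"
  shows "mp_bijection M (inv_into (space M) \<phi>)"
proof (rule mp_bijectionI[where \<psi> = \<phi>])
  let ?\<psi> = "inv_into (space M) \<phi>"
  note [measurable] = mp_bijection_measurable[OF assms] mp_bijection_inv_into_measurable[OF assms]
  \<comment> \<open>\<open>M\<close> is rewritten as its own image under \<open>\<phi>\<close>,
    which the inverse then undoes.\<close>
  have "distr M M ?\<psi> = distr (distr M M \<phi>) M ?\<psi>"
    by (simp add: mp_bijection_distr[OF assms])
  also have "\<dots> = distr M M (?\<psi> \<circ> \<phi>)"
    by (rule distr_distr) measurable
  also have "\<dots> = distr M M (\<lambda>x. x)"
    by (rule distr_cong) (auto simp: mp_bijection_inverse_cancel[OF assms])
  finally show "distr M M ?\<psi> = M" by (simp add: distr_id2)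
qed (use assms in \<open>auto simp: mp_bijection_def bij_betw_inv_into_left bij_betw_inv_into_right\<close>)

lemma mp_bijection_comp:
  assumes "mp_bijection M \<phi>" "mp_bijection M \<rho>"
  shows "mp_bijection M (\<phi> \<circ> \<rho>)"
proof (rule mp_bijectionI[where \<psi> = "inv_into (space M) \<rho> \<circ> inv_into (space M) \<phi>"])
  note [measurable] = assms[THEN mp_bijection_measurable] assms[THEN mp_bijection_inv_into_measurable]
  show "\<phi> \<circ> \<rho> \<in> measurable M M" "inv_into (space M) \<rho> \<circ> inv_into (space M) \<phi> \<in> measurable M M"
    by (auto simp: comp_def)
  show "(inv_into (space M) \<rho> \<circ> inv_into (space M) \<phi>) ((\<phi> \<circ> \<rho>) x) = x"
    "(\<phi> \<circ> \<rho>) ((inv_into (space M) \<rho> \<circ> inv_into (space M) \<phi>) x) = x" if "x \<in> space M" for x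
    using that assms[THEN mp_bijection_inverse_cancel(1)] assms[THEN mp_bijection_inverse_cancel(2)]
      assms[THEN mp_bijection_measurable, THEN measurable_space]
      assms[THEN mp_bijection_inv_into_measurable, THEN measurable_space]
    by simp_all
  have "distr M M (\<phi> \<circ> \<rho>) = distr (distr M M \<rho>) M \<phi>"
    by (rule distr_distr[symmetric]) measurable
  then show "distr M M (\<phi> \<circ> \<rho>) = M"
    using assms by (simp add: mp_bijection_distr)
qed

section \<open>Graphons and their envelopes\<close>

text \<open>Makes a graphon a single random variable on the product space, to which the results on
  convex order apply.\<close>

abbreviation uncurry :: "('a \<Rightarrow> 'a \<Rightarrow> real) \<Rightarrow> 'a \<times> 'a \<Rightarrow> real" where
  "uncurry W \<equiv> \<lambda>z. W (fst z) (snd z)"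

lemma graphonD:
  assumes "graphon M W"
  shows "uncurry W \<in> borel_measurable (M \<Otimes>\<^sub>M M)"
    and "z \<in> space (M \<Otimes>\<^sub>M M) \<Longrightarrow> uncurry W z \<in> {0..1}"
  using assms by (auto simp: graphon_def space_pair_measure case_prod_beta')

lemma graphon_pullback:
  assumes "graphon M W" "mp_bijection M \<phi>"
  shows "graphon M (pullback W \<phi>)"
  unfolding graphon_def
proof (intro conjI ballI)
  note [measurable] = mp_bijection_measurable[OF assms(2)]
  have "(\<lambda>z. W (\<phi> (fst z)) (\<phi> (snd z))) \<in> borel_measurable (M \<Otimes>\<^sub>M M)"
    using measurable_compose[OF _ graphonD(1)[OF assms(1)], of "\<lambda>z. (\<phi> (fst z), \<phi> (snd z))" "M \<Otimes>\<^sub>M M"]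
    by simp
  then show "(\<lambda>(x, y). pullback W \<phi> x y) \<in> borel_measurable (M \<Otimes>\<^sub>M M)"
    by (simp add: pullback_def case_prod_beta')
  fix x y assume "x \<in> space M" "y \<in> space M"
  then have "\<phi> x \<in> space M" "\<phi> y \<in> space M"
    using measurable_space[OF mp_bijection_measurable[OF assms(2)]] by auto
  then show "pullback W \<phi> x y = pullback W \<phi> y x" "pullback W \<phi> x y \<in> {0..1}"
    using assms(1) by (auto simp: graphon_def pullback_def)
qed

context prob_space
begin

lemma prob_space_pair_self: "prob_space (M \<Otimes>\<^sub>M M)"
proof -
  interpret pair_prob_space M M ..
  show ?thesis by unfold_locales
qed

text \<open>Applying \<open>\<phi>\<close> in both coordinates preserves the product
  measure.\<close>

lemma integral_mp_bijection:
  assumes "mp_bijection M \<phi>" and [measurable]: "g \<in> borel_measurable (M \<Otimes>\<^sub>M M)"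
  shows "(\<integral>z. g (\<phi> (fst z), \<phi> (snd z)) \<partial>(M \<Otimes>\<^sub>M M)) = (\<integral>z. g z \<partial>(M \<Otimes>\<^sub>M M) :: real)"
proof -
  note [measurable] = mp_bijection_measurable[OF assms(1)]
  have "sigma_finite_measure (distr M M \<phi>)"
    by (simp add: mp_bijection_distr[OF assms(1)] sigma_finite_measure_axioms)
  then have "M \<Otimes>\<^sub>M M = distr (M \<Otimes>\<^sub>M M) (M \<Otimes>\<^sub>M M) (\<lambda>(x, y). (\<phi> x, \<phi> y))"
    using pair_measure_distr[of \<phi> M M \<phi> M M] by (simp add: mp_bijection_distr[OF assms(1)])
  also have "(\<integral>z. g z \<partial>\<dots>) = (\<integral>z. g (\<phi> (fst z), \<phi> (snd z)) \<partial>(M \<Otimes>\<^sub>M M))"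
    by (subst integral_distr) (auto simp: case_prod_beta')
  finally show ?thesis by simp
qed

text \<open>This is Fubini; convexity supplies the measurability and boundedness behind its
  integrability hypothesis.\<close>

lemma INT_param_eq:
  assumes "graphon M W" "convex_on {0..1} f"
  shows "INT_param M f W = (\<integral>z. f (uncurry W z) \<partial>(M \<Otimes>\<^sub>M M))"
proof -
  note P = prob_space_pair_self
  interpret pair_prob_space M M ..
  have "integrable (M \<Otimes>\<^sub>M M) (\<lambda>z. f (uncurry W z))"
    by (rule prob_space.convex_comp_integrable[OF P graphonD(1)[OF assms(1)]
          graphonD(2)[OF assms(1)] assms(2)])
  then show ?thesis
    unfolding INT_param_def using integral_fst[of "\<lambda>x y. f (W x y)"]
    by (simp add: case_prod_beta')
qed

lemma graphon_integrable_diff: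
  assumes "graphon M V" "graphon M W"
  shows "integrable (M \<Otimes>\<^sub>M M) (\<lambda>z. uncurry V z - uncurry W z)"
    and "z \<in> space (M \<Otimes>\<^sub>M M) \<Longrightarrow> \<bar>uncurry V z - uncurry W z\<bar> \<le> 1"
proof -
  interpret P: prob_space "M \<Otimes>\<^sub>M M" by (rule prob_space_pair_self)
  note [measurable] = graphonD(1)[OF assms(1)] graphonD(1)[OF assms(2)]
  show *: "\<bar>uncurry V z - uncurry W z\<bar> \<le> 1" if "z \<in> space (M \<Otimes>\<^sub>M M)" for z
    using graphonD(2)[OF assms(1) that] graphonD(2)[OF assms(2) that] by (auto simp: abs_le_iff)
  show "integrable (M \<Otimes>\<^sub>M M) (\<lambda>z. uncurry V z - uncurry W z)"
    by (rule P.integrable_const_bound[where B = 1]) (use * in \<open>auto intro!: AE_I2\<close>)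
qed

section \<open>Weak* convergence of graphons\<close>

lemma integrable_mult_graphon:
  assumes "graphon M W" "integrable (M \<Otimes>\<^sub>M M) g"
  shows "integrable (M \<Otimes>\<^sub>M M) (\<lambda>z. g z * uncurry W z)"
proof (rule prob_space.integrable_mult_bounded[OF prob_space_pair_self])
  show "\<bar>uncurry W z\<bar> \<le> 1" if "z \<in> space (M \<Otimes>\<^sub>M M)" for z
    using graphonD(2)[OF assms(1) that] by simp
qed (use assms in \<open>auto intro: graphonD\<close>)

text \<open>The definition tests on rectangles only. These form an intersection-stable generator
  containing the whole space, and differences of graphons are bounded by 1.\<close>

lemma weak_star_conv_mult:
  assumes V: "\<And>n. graphon M (V n)" and W: "graphon M W" and conv: "weak_star_conv M V W"
    and g: "integrable (M \<Otimes>\<^sub>M M) g"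
  shows "(\<lambda>n. \<integral>z. g z * uncurry (V n) z \<partial>(M \<Otimes>\<^sub>M M))
    \<longlonglongrightarrow> (\<integral>z. g z * uncurry W z \<partial>(M \<Otimes>\<^sub>M M))"
proof -
  interpret P: prob_space "M \<Otimes>\<^sub>M M" by (rule prob_space_pair_self)
  let ?D = "\<lambda>n z. uncurry (V n) z - uncurry W z"
  have split: "(\<integral>z. h z * ?D n z \<partial>(M \<Otimes>\<^sub>M M))
    = (\<integral>z. h z * uncurry (V n) z \<partial>(M \<Otimes>\<^sub>M M)) - (\<integral>z. h z * uncurry W z \<partial>(M \<Otimes>\<^sub>M M))"
    if "integrable (M \<Otimes>\<^sub>M M) h" for h n
    using Bochner_Integration.integral_diff[OF integrable_mult_graphon[OF V that]
        integrable_mult_graphon[OF W that]]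
    by (simp add: right_diff_distrib)
  have "(\<lambda>n. \<integral>z. g z * ?D n z \<partial>(M \<Otimes>\<^sub>M M)) \<longlonglongrightarrow> 0"
  proof (rule P.tendsto_integral_mult_of_generator[where G = "{S \<times> T |S T. S \<in> sets M \<and> T \<in> sets M}"])
    show "Int_stable {S \<times> T |S T. S \<in> sets M \<and> T \<in> sets M}"
      by (rule Int_stable_pair_measure_generator)
    show "{S \<times> T |S T. S \<in> sets M \<and> T \<in> sets M} \<subseteq> Pow (space (M \<Otimes>\<^sub>M M))"
      using pair_measure_closed[of M M] by (simp add: space_pair_measure)
    show "sets (M \<Otimes>\<^sub>M M) = sigma_sets (space (M \<Otimes>\<^sub>M M)) {S \<times> T |S T. S \<in> sets M \<and> T \<in> sets M}"
      by (simp add: sets_pair_measure space_pair_measure)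
    show "space (M \<Otimes>\<^sub>M M) \<in> {S \<times> T |S T. S \<in> sets M \<and> T \<in> sets M}"
      by (auto simp: space_pair_measure)
    show "(\<lambda>n. \<integral>z. indicator A z * ?D n z \<partial>(M \<Otimes>\<^sub>M M)) \<longlonglongrightarrow> 0"
      if "A \<in> {S \<times> T |S T. S \<in> sets M \<and> T \<in> sets M}" for A
    proof -
      from that obtain S T where A: "A = S \<times> T" "S \<in> sets M" "T \<in> sets M" by auto
      then have "integrable (M \<Otimes>\<^sub>M M) (indicator A :: _ \<Rightarrow> real)"
        by (intro integrable_real_indicator) (auto simp: P.emeasure_eq_measure)
      moreover have "(\<lambda>n. \<integral>z. indicator A z * uncurry (V n) z \<partial>(M \<Otimes>\<^sub>M M))
        \<longlonglongrightarrow> (\<integral>z. indicator A z * uncurry W z \<partial>(M \<Otimes>\<^sub>M M))"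
        using conv A unfolding weak_star_conv_def set_lebesgue_integral_def by (simp add: case_prod_beta')
      ultimately show ?thesis
        by (simp only: split LIM_zero)
    qed
    show "?D n \<in> borel_measurable (M \<Otimes>\<^sub>M M)" for n
      using graphonD(1)[OF V] graphonD(1)[OF W] by (intro borel_measurable_diff)
    show "\<bar>?D n z\<bar> \<le> 1" if "z \<in> space (M \<Otimes>\<^sub>M M)" for n z
      using graphon_integrable_diff(2)[OF V W that] .
  qed (rule g)
  then show ?thesis
    unfolding split[OF g] by (rule LIM_zero_cancel)
qed

text \<open>Over any rectangle the integrals of \<open>V n\<close> and \<open>V' n\<close> differ by
  at most the L1 distance.\<close>

lemma weak_star_conv_L1_perturb:
  assumes V: "\<And>n. graphon M (V n)" "\<And>n. graphon M (V' n)" and conv: "weak_star_conv M V U"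
    and L1: "(\<lambda>n. \<integral>z. \<bar>uncurry (V' n) z - uncurry (V n) z\<bar> \<partial>(M \<Otimes>\<^sub>M M)) \<longlonglongrightarrow> 0"
  shows "weak_star_conv M V' U"
  unfolding weak_star_conv_def
proof (intro ballI)
  interpret P: prob_space "M \<Otimes>\<^sub>M M" by (rule prob_space_pair_self)
  fix S T assume ST: "S \<in> sets M" "T \<in> sets M"
  let ?I = "\<lambda>F. set_lebesgue_integral (M \<Otimes>\<^sub>M M) (S \<times> T) (\<lambda>(x, y). F x y)"
  have ind: "integrable (M \<Otimes>\<^sub>M M) (indicator (S \<times> T) :: _ \<Rightarrow> real)"
    using ST by (intro integrable_real_indicator) (auto simp: P.emeasure_eq_measure)
  have "\<bar>?I (V' n) - ?I (V n)\<bar> \<le> (\<integral>z. \<bar>uncurry (V' n) z - uncurry (V n) z\<bar> \<partial>(M \<Otimes>\<^sub>M M))" for n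
  proof -
    have int: "integrable (M \<Otimes>\<^sub>M M) (\<lambda>z. indicator (S \<times> T) z * uncurry (V' n) z
        - indicator (S \<times> T) z * uncurry (V n) z)"
      using integrable_mult_graphon[OF V(1) ind] integrable_mult_graphon[OF V(2) ind] by auto
    have "?I (V' n) - ?I (V n)
      = (\<integral>z. indicator (S \<times> T) z * uncurry (V' n) z - indicator (S \<times> T) z * uncurry (V n) z \<partial>(M \<Otimes>\<^sub>M M))"
      unfolding set_lebesgue_integral_def real_scaleR_def case_prod_beta'
      using Bochner_Integration.integral_diff[OF integrable_mult_graphon[OF V(2)[of n] ind]
          integrable_mult_graphon[OF V(1)[of n] ind]]
      by simp
    also have "\<bar>\<dots>\<bar> \<le> (\<integral>z. \<bar>indicator (S \<times> T) z * uncurry (V' n) z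
        - indicator (S \<times> T) z * uncurry (V n) z\<bar> \<partial>(M \<Otimes>\<^sub>M M))"
      by (rule integral_abs_bound)
    also have "\<dots> \<le> (\<integral>z. \<bar>uncurry (V' n) z - uncurry (V n) z\<bar> \<partial>(M \<Otimes>\<^sub>M M))"
      by (intro integral_mono integrable_abs int graphon_integrable_diff(1)[OF V(2) V(1)])
         (auto split: split_indicator)
    finally show ?thesis .
  qed
  then have "(\<lambda>n. ?I (V' n) - ?I (V n)) \<longlonglongrightarrow> 0"
    by (intro Lim_null_comparison[OF _ L1]) auto
  moreover have "(\<lambda>n. ?I (V n)) \<longlonglongrightarrow> ?I U"
    using conv ST unfolding weak_star_conv_def by simp
  ultimately have "(\<lambda>n. (?I (V' n) - ?I (V n)) + ?I (V n)) \<longlonglongrightarrow> 0 + ?I U"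
    by (rule tendsto_add)
  then show "(\<lambda>n. ?I (V' n)) \<longlonglongrightarrow> ?I U" by simp
qed

text \<open>Constant identity bijections witness this; it turns an inclusion of envelopes into
  membership of the smaller graphon in the larger envelope.\<close>

lemma graphon_in_envelope: "graphon M W \<Longrightarrow> W \<in> envelope M W"
  unfolding envelope_def
  by (auto intro!: exI[of _ "\<lambda>_ x. x"] mp_bijection_id simp: pullback_def weak_star_conv_def)

text \<open>Provides the two hypotheses of convex order, with \<open>U\<close> below
  \<open>W\<close>.\<close>

lemma envelope_hinge_gap:
  assumes U: "graphon M U" and W: "graphon M W" and env: "U \<in> envelope M W"
  shows "(\<integral>z. uncurry U z \<partial>(M \<Otimes>\<^sub>M M)) = (\<integral>z. uncurry W z \<partial>(M \<Otimes>\<^sub>M M))"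
    and "0 \<le> prob_space.hinge_gap (M \<Otimes>\<^sub>M M) (uncurry U) (uncurry W) t"
proof -
  interpret P: prob_space "M \<Otimes>\<^sub>M M" by (rule prob_space_pair_self)
  obtain \<pi> where \<pi>: "\<And>n. mp_bijection M (\<pi> n)" and conv: "weak_star_conv M (\<lambda>n. pullback W (\<pi> n)) U"
    using env unfolding envelope_def by auto
  note V = graphon_pullback[OF W \<pi>]
  note wm = weak_star_conv_mult[OF V U conv]
  note [measurable] = graphonD(1)[OF U] graphonD(1)[OF W]
  have same: "(\<integral>z. h (uncurry (pullback W (\<pi> n)) z) \<partial>(M \<Otimes>\<^sub>M M)) = (\<integral>z. h (uncurry W z) \<partial>(M \<Otimes>\<^sub>M M))"
    if [measurable]: "h \<in> borel_measurable borel" for h :: "real \<Rightarrow> real" and n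
    using integral_mp_bijection[OF \<pi>[of n], of "\<lambda>z. h (uncurry W z)"]
    by (simp add: pullback_def case_prod_beta')
  \<comment> \<open>With the test function 1 the sequence is constant, since every pullback has the
    integral of \<open>W\<close>.\<close>
  have "(\<lambda>n. \<integral>z. uncurry W z \<partial>(M \<Otimes>\<^sub>M M)) \<longlonglongrightarrow> (\<integral>z. uncurry U z \<partial>(M \<Otimes>\<^sub>M M))"
    using wm[of "\<lambda>_. 1"] same[of "\<lambda>x. x"] by simp
  then show "(\<integral>z. uncurry U z \<partial>(M \<Otimes>\<^sub>M M)) = (\<integral>z. uncurry W z \<partial>(M \<Otimes>\<^sub>M M))"
    by (simp add: LIMSEQ_const_iff)
  \<comment> \<open>Integrating \<open>F - t\<close> over any set gives at most the hinge integral
    of \<open>F\<close>. For \<open>U\<close> this set attains it; for the pullbacks the bound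
    suffices, and it does not depend on \<open>n\<close>.\<close>
  let ?A = "{z \<in> space (M \<Otimes>\<^sub>M M). t < uncurry U z}"
  have ind: "integrable (M \<Otimes>\<^sub>M M) (indicator ?A :: _ \<Rightarrow> real)"
    by (intro integrable_real_indicator) (auto simp: P.emeasure_eq_measure)
  have expand: "(\<integral>z. indicator ?A z * (uncurry F z - t) \<partial>(M \<Otimes>\<^sub>M M))
    = (\<integral>z. indicator ?A z * uncurry F z \<partial>(M \<Otimes>\<^sub>M M)) - t * P.prob ?A"
    and int: "integrable (M \<Otimes>\<^sub>M M) (\<lambda>z. indicator ?A z * (uncurry F z - t))" if "graphon M F" for F
  proof -
    have eq: "indicator ?A z * (F (fst z) (snd z) - t)
        = indicator ?A z * F (fst z) (snd z) - t * indicator ?A z" for z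
      by (simp add: right_diff_distrib)
    show "(\<integral>z. indicator ?A z * (uncurry F z - t) \<partial>(M \<Otimes>\<^sub>M M))
        = (\<integral>z. indicator ?A z * uncurry F z \<partial>(M \<Otimes>\<^sub>M M)) - t * P.prob ?A"
      and "integrable (M \<Otimes>\<^sub>M M) (\<lambda>z. indicator ?A z * (uncurry F z - t))"
      unfolding eq using integrable_mult_graphon[OF that ind] ind by simp_all
  qed
  have "(\<lambda>n. \<integral>z. indicator ?A z * (uncurry (pullback W (\<pi> n)) z - t) \<partial>(M \<Otimes>\<^sub>M M))
    \<longlonglongrightarrow> (\<integral>z. indicator ?A z * (uncurry U z - t) \<partial>(M \<Otimes>\<^sub>M M))"
    unfolding expand[OF V] expand[OF U] by (intro tendsto_intros wm ind)
  moreover have "(\<integral>z. indicator ?A z * (uncurry U z - t) \<partial>(M \<Otimes>\<^sub>M M))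
      = (\<integral>z. hinge t (uncurry U z) \<partial>(M \<Otimes>\<^sub>M M))"
    by (rule Bochner_Integration.integral_cong) (auto simp: hinge_def split: split_indicator)
  moreover have "(\<integral>z. indicator ?A z * (uncurry (pullback W (\<pi> n)) z - t) \<partial>(M \<Otimes>\<^sub>M M))
    \<le> (\<integral>z. hinge t (uncurry W z) \<partial>(M \<Otimes>\<^sub>M M))" for n
  proof -
    have "(\<integral>z. indicator ?A z * (uncurry (pullback W (\<pi> n)) z - t) \<partial>(M \<Otimes>\<^sub>M M))
      \<le> (\<integral>z. hinge t (uncurry (pullback W (\<pi> n)) z) \<partial>(M \<Otimes>\<^sub>M M))"
      by (intro integral_mono int V P.integrable_hinge graphonD[OF V])
         (auto simp: hinge_def split: split_indicator)
    then show ?thesis using same[of "hinge t" n] by simp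
  qed
  ultimately have "(\<integral>z. hinge t (uncurry U z) \<partial>(M \<Otimes>\<^sub>M M)) \<le> (\<integral>z. hinge t (uncurry W z) \<partial>(M \<Otimes>\<^sub>M M))"
    by (auto intro: LIMSEQ_le_const2)
  then show "0 \<le> P.hinge_gap (uncurry U) (uncurry W) t"
    by (simp add: P.hinge_gap_def)
qed

lemma INT_param_mono:
  assumes "graphon M U" "graphon M W" "U \<in> envelope M W" "convex_on {0..1} f"
  shows "INT_param M f U \<le> INT_param M f W"
  unfolding INT_param_eq[OF assms(1,4)] INT_param_eq[OF assms(2,4)]
  by (intro prob_space.expectation_convex_mono[OF prob_space_pair_self _ _ _ _ _ _ assms(4)]
      graphonD[OF assms(1)] graphonD[OF assms(2)] envelope_hinge_gap[OF assms(1-3)])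

text \<open>
  By weak* convergence the mixed term of \<open>\<parallel>W\<^sup>\<pi> - U\<parallel>\<^sup>2\<close> tends to \<open>-2 \<parallel>U\<parallel>\<^sup>2\<close>, so equality of the
  second moments of \<open>U\<close> and \<open>W\<close> makes the whole expression vanish in the limit.
\<close>

lemma weak_star_conv_imp_L1:
  assumes U: "graphon M U" and V: "\<And>n. graphon M (V n)" and conv: "weak_star_conv M V U"
    and sq: "\<And>n. (\<integral>z. (uncurry (V n) z)\<^sup>2 \<partial>(M \<Otimes>\<^sub>M M)) = (\<integral>z. (uncurry U z)\<^sup>2 \<partial>(M \<Otimes>\<^sub>M M))"
  shows "(\<lambda>n. \<integral>z. \<bar>uncurry (V n) z - uncurry U z\<bar> \<partial>(M \<Otimes>\<^sub>M M)) \<longlonglongrightarrow> 0"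
proof -
  interpret P: prob_space "M \<Otimes>\<^sub>M M" by (rule prob_space_pair_self)
  have i1: "integrable (M \<Otimes>\<^sub>M M) (uncurry F)" if "graphon M F" for F
    using integrable_mult_graphon[OF that, of "\<lambda>_. 1"] by simp
  have i2: "integrable (M \<Otimes>\<^sub>M M) (\<lambda>z. uncurry F z * uncurry G z)" if "graphon M F" "graphon M G" for F G
    using integrable_mult_graphon[OF that(2) i1[OF that(1)]] .
  let ?s = "\<integral>z. (uncurry U z)\<^sup>2 \<partial>(M \<Otimes>\<^sub>M M)"
  let ?d = "\<lambda>n. \<integral>z. (uncurry (V n) z - uncurry U z)\<^sup>2 \<partial>(M \<Otimes>\<^sub>M M)"
  have d: "?d n = ?s + ?s - 2 * (\<integral>z. uncurry U z * uncurry (V n) z \<partial>(M \<Otimes>\<^sub>M M))" for n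
  proof -
    have "?d n
      = (\<integral>z. (uncurry (V n) z)\<^sup>2 + (uncurry U z)\<^sup>2 - 2 * (uncurry U z * uncurry (V n) z) \<partial>(M \<Otimes>\<^sub>M M))"
      by (simp add: power2_diff algebra_simps)
    also have "\<dots> = (\<integral>z. (uncurry (V n) z)\<^sup>2 \<partial>(M \<Otimes>\<^sub>M M)) + ?s
        - 2 * (\<integral>z. uncurry U z * uncurry (V n) z \<partial>(M \<Otimes>\<^sub>M M))"
      using i2[OF V V, of n n] i2[OF U U] i2[OF U V, of n] by (simp add: power2_eq_square)
    finally show ?thesis by (simp add: sq)
  qed
  have "(\<lambda>n. ?s + ?s - 2 * (\<integral>z. uncurry U z * uncurry (V n) z \<partial>(M \<Otimes>\<^sub>M M)))
    \<longlonglongrightarrow> ?s + ?s - 2 * (\<integral>z. uncurry U z * uncurry U z \<partial>(M \<Otimes>\<^sub>M M))"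
    by (intro tendsto_intros weak_star_conv_mult V U conv i1)
  then have "?d \<longlonglongrightarrow> 0"
    unfolding d by (simp add: power2_eq_square)
  then have sqrt: "(\<lambda>n. sqrt (?d n)) \<longlonglongrightarrow> 0"
    using tendsto_real_sqrt by fastforce
  \<comment> \<open>Cauchy-Schwarz against the constant 1, obtained from nonnegativity of the
    variance of the absolute difference.\<close>
  have "(\<integral>z. \<bar>uncurry (V n) z - uncurry U z\<bar> \<partial>(M \<Otimes>\<^sub>M M)) \<le> sqrt (?d n)" for n
  proof (rule real_le_rsqrt)
    have "integrable (M \<Otimes>\<^sub>M M) (\<lambda>z. (uncurry (V n) z - uncurry U z)\<^sup>2)"
      using i2[OF V V, of n n] i2[OF U U] i2[OF V U, of n]
      by (simp add: power2_eq_square left_diff_distrib right_diff_distrib mult.commute)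
    then have "P.variance (\<lambda>z. \<bar>uncurry (V n) z - uncurry U z\<bar>)
        = ?d n - (\<integral>z. \<bar>uncurry (V n) z - uncurry U z\<bar> \<partial>(M \<Otimes>\<^sub>M M))\<^sup>2"
      using graphon_integrable_diff(1)[OF V U, of n] by (subst P.variance_eq) auto
    then show "(\<integral>z. \<bar>uncurry (V n) z - uncurry U z\<bar> \<partial>(M \<Otimes>\<^sub>M M))\<^sup>2 \<le> ?d n"
      using P.variance_positive[of "\<lambda>z. \<bar>uncurry (V n) z - uncurry U z\<bar>"] by simp
  qed
  then show ?thesis
    by (intro Lim_null_comparison[OF _ sqrt]) auto
qed

section \<open>Comparison of envelopes and the strict inequality\<close>

lemma integral_pullback_diff:
  assumes "graphon M U" "graphon M W" "mp_bijection M \<phi>"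
  shows "(\<integral>z. \<bar>uncurry (pullback U \<phi>) z - uncurry (pullback W \<phi>) z\<bar> \<partial>(M \<Otimes>\<^sub>M M))
    = (\<integral>z. \<bar>uncurry U z - uncurry W z\<bar> \<partial>(M \<Otimes>\<^sub>M M))"
proof -
  note [measurable] = graphonD(1)[OF assms(1)] graphonD(1)[OF assms(2)]
  show ?thesis
    using integral_mp_bijection[OF assms(3), of "\<lambda>z. \<bar>uncurry U z - uncurry W z\<bar>"]
    by (simp add: pullback_def case_prod_beta')
qed

text \<open>If \<open>W\<close> moved by \<open>\<rho> n\<close> tends weak* to \<open>F\<close>,
  then so does \<open>U\<close> moved by \<open>\<sigma> n\<close>: by invariance, the L1 distance
  between the two equals that between \<open>W\<close> moved by \<open>\<pi> n\<close> and
  \<open>U\<close>.\<close>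

lemma envelope_subset_of_L1:
  assumes U: "graphon M U" and W: "graphon M W" and \<pi>: "\<And>n. mp_bijection M (\<pi> n)"
    and L1: "(\<lambda>n. \<integral>z. \<bar>uncurry (pullback W (\<pi> n)) z - uncurry U z\<bar> \<partial>(M \<Otimes>\<^sub>M M)) \<longlonglongrightarrow> 0"
  shows "envelope M W \<subseteq> envelope M U"
proof
  fix F assume "F \<in> envelope M W"
  then obtain \<rho> where F: "graphon M F" and \<rho>: "\<And>n. mp_bijection M (\<rho> n)"
    and conv: "weak_star_conv M (\<lambda>n. pullback W (\<rho> n)) F"
    unfolding envelope_def by auto
  \<comment> \<open>Chosen so that \<open>\<pi> n \<circ> \<sigma> n\<close> agrees with
    \<open>\<rho> n\<close> on the space.\<close>
  define \<sigma> where "\<sigma> n = inv_into (space M) (\<pi> n) \<circ> \<rho> n" for n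
  have \<sigma>: "mp_bijection M (\<sigma> n)" for n
    unfolding \<sigma>_def by (intro mp_bijection_comp mp_bijection_inv_into \<pi> \<rho>)
  have "(\<integral>z. \<bar>uncurry (pullback U (\<sigma> n)) z - uncurry (pullback W (\<rho> n)) z\<bar> \<partial>(M \<Otimes>\<^sub>M M))
    = (\<integral>z. \<bar>uncurry (pullback W (\<pi> n)) z - uncurry U z\<bar> \<partial>(M \<Otimes>\<^sub>M M))" for n
  proof -
    have "\<pi> n (\<sigma> n x) = \<rho> n x" if "x \<in> space M" for x
      using mp_bijection_inverse_cancel(2)[OF \<pi>] measurable_space[OF mp_bijection_measurable[OF \<rho>] that]
      by (simp add: \<sigma>_def)
    then have "(\<integral>z. \<bar>uncurry (pullback U (\<sigma> n)) z - uncurry (pullback W (\<rho> n)) z\<bar> \<partial>(M \<Otimes>\<^sub>M M))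
      = (\<integral>z. \<bar>uncurry (pullback U (\<sigma> n)) z - uncurry (pullback (pullback W (\<pi> n)) (\<sigma> n)) z\<bar> \<partial>(M \<Otimes>\<^sub>M M))"
      by (intro Bochner_Integration.integral_cong) (auto simp: pullback_def space_pair_measure)
    also have "\<dots> = (\<integral>z. \<bar>uncurry U z - uncurry (pullback W (\<pi> n)) z\<bar> \<partial>(M \<Otimes>\<^sub>M M))"
      by (rule integral_pullback_diff[OF U graphon_pullback[OF W \<pi>] \<sigma>])
    finally show ?thesis by (simp add: abs_minus_commute)
  qed
  then have "weak_star_conv M (\<lambda>n. pullback U (\<sigma> n)) F"
    using L1
    by (intro weak_star_conv_L1_perturb[OF graphon_pullback[OF W \<rho>] graphon_pullback[OF U \<sigma>] conv])
       simp
  then show "F \<in> envelope M U"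
    unfolding envelope_def using F \<sigma> by auto
qed

text \<open>Without strict inequality the second moments agree, weak* convergence becomes L1
  convergence, and the excluded inclusion of envelopes follows.\<close>

lemma INT_param_strict_mono:
  assumes U: "graphon M U" and W: "graphon M W" and env: "U \<in> envelope M W"
    and f: "strictly_convex_on {0..1} f" and not: "\<not> envelope M W \<subseteq> envelope M U"
  shows "INT_param M f U < INT_param M f W"
proof (rule ccontr)
  assume "\<not> INT_param M f U < INT_param M f W"
  then have le: "(\<integral>z. f (uncurry W z) \<partial>(M \<Otimes>\<^sub>M M)) \<le> (\<integral>z. f (uncurry U z) \<partial>(M \<Otimes>\<^sub>M M))"
    using INT_param_eq[OF U] INT_param_eq[OF W] strictly_convex_imp_convex_on[OF f] by simp
  obtain \<pi> where \<pi>: "\<And>n. mp_bijection M (\<pi> n)" and conv: "weak_star_conv M (\<lambda>n. pullback W (\<pi> n)) U"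
    using env unfolding envelope_def by auto
  have sq: "(\<integral>z. (uncurry U z)\<^sup>2 \<partial>(M \<Otimes>\<^sub>M M)) = (\<integral>z. (uncurry W z)\<^sup>2 \<partial>(M \<Otimes>\<^sub>M M))"
    by (intro prob_space.expectation_power2_eq[OF prob_space_pair_self _ _ _ _ _ _ f le]
        graphonD[OF U] graphonD[OF W] envelope_hinge_gap[OF U W env])
  note [measurable] = graphonD(1)[OF W]
  have "(\<integral>z. (uncurry (pullback W (\<pi> n)) z)\<^sup>2 \<partial>(M \<Otimes>\<^sub>M M)) = (\<integral>z. (uncurry U z)\<^sup>2 \<partial>(M \<Otimes>\<^sub>M M))" for n
    using integral_mp_bijection[OF \<pi>[of n], of "\<lambda>z. (uncurry W z)\<^sup>2"] sq
    by (simp add: pullback_def case_prod_beta')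
  from weak_star_conv_imp_L1[OF U graphon_pullback[OF W \<pi>] conv this]
  have "envelope M W \<subseteq> envelope M U"
    by (rule envelope_subset_of_L1[OF U W \<pi>])
  with not show False by contradiction
qed

end

theorem theorem3p14:
  fixes M :: "'a measure" and f :: "real \<Rightarrow> real"
  assumes "prob_space M" and "standard_borel M" and "atomless M"
  shows "(convex_on {0..1} f \<longrightarrow> cut_distance_compatible M (INT_param M f)) \<and>
         (strictly_convex_on {0..1} f \<longrightarrow> cut_distance_identifying M (INT_param M f))"
proof -
  interpret prob_space M by fact
  show ?thesis
    unfolding cut_distance_compatible_def cut_distance_identifying_def
      structurally_less_def structurally_le_def
    using graphon_in_envelope INT_param_mono INT_param_strict_mono by blast
qed

end
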